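(* Let $d,n\ge 1$ and let $\mathcal{A}$ be a space of nested hyperplane partitions of $\mathbb{R}^d$ into $n$ parts with fixed directions. Then, for any $n$ absolutely continuous probability measures $\mu_1,\dots,\mu_n$ on $\mathbb{R}^d$, there exists an envy-free partition in $\mathcal{A}$ for $\mu_1,\dots,\mu_n$. Moreover, this partition can be found without access to one of the measures in advance: given $\mu_1,\dots,\mu_{n-1}$, there is a partition in $\mathcal{A}$ that, for every absolutely continuous probability measure $\mu_n$ on $\mathbb{R}^d$, is an envy-free partition for $\mu_1,\dots,\mu_n$.
   Context: A measure on $\mathbb{R}^d$ is called absolutely continuous if it is absolutely continuous with respect to the Lebesgue measure. Write $[n]=\{1,\dots,n\}$. Spaces of nested hyperplane partitions of $\mathbb{R}^d$ with fixed directions are defined recursively. For $n=1$, the only such space consists of the single partition $(\mathbb{R}^d)$. For $n>1$, let $\mathcal{A}'$ be a space of nested hyperplane partitions of $\mathbb{R}^d$ into $n-1$ parts with fixed directions, let $v\in S^{d-1}$ be a direction and let $j\in[n-1]$. These data determine a space $\mathcal{A}$ of nested hyperplane partitions into $n$ parts: it consists of all partitions obtained from some $(C_1,\dots,C_{n-1})\in\mathcal{A}'$ by cutting $C_j$ (always the $j$-th piece) into the two parts $C_j'=C_j\cap\{y:\langle y,v\rangle\ge\beta\}$ and $C_j''=C_j\cap\{y:\langle y,v\rangle\le\beta\}$ by a hyperplane orthogonal to $v$, where $\beta$ is arbitrary (the limiting cases $\beta=\pm\infty$, where one of the two parts is empty and the other is $C_j$, are included). Thus $v$ and $j$ at each step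 are fixed for the whole space, while the positions $\beta$ of the hyperplanes vary freely. A partition $(C_1,\dots,C_n)$ of $\mathbb{R}^d$ is an envy-free partition for $\mu_1,\dots,\mu_n$ if there is a permutation $\pi:[n]\to[n]$ such that $\mu_i(C_{\pi(i)})\ge\mu_i(C_{\pi(i')})$ for all $i,i'\in[n]$. *)

theory Defs
  imports "HOL-Probability.Probability" "HOL-Combinatorics.Permutations"
begin

text \<open>
  A partition into n parts is a list of length n. All indices are shifted by one: the index set
  [n] is rendered as \<open>{..<n}\<close>, and likewise for the measures.
\<close>

text \<open>
  The two new pieces take the place of the piece that is cut, and later pieces move up by one.
  The position \<open>\<beta>\<close> is an extended real, so that \<open>\<beta> = \<infinity>\<close> and \<open>\<beta> = -\<infinity>\<close> are the limiting cases in
  which one of the two new pieces is empty and the other one is the old piece.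
\<close>

definition cut_piece :: "'a::euclidean_space \<Rightarrow> nat \<Rightarrow> ereal \<Rightarrow> 'a set list \<Rightarrow> 'a set list" where
  "cut_piece v j \<beta> C =
     take j C
     @ [C ! j \<inter> {y. ereal (y \<bullet> v) \<ge> \<beta>}, C ! j \<inter> {y. ereal (y \<bullet> v) \<le> \<beta>}]
     @ drop (Suc j) C"

inductive nested_hyperplane_space :: "nat \<Rightarrow> ('a::euclidean_space) set list set \<Rightarrow> bool" where
  single: "nested_hyperplane_space 1 {[UNIV]}"
| cut: "nested_hyperplane_space n \<A> \<Longrightarrow> v \<in> sphere 0 1 \<Longrightarrow> j < n \<Longrightarrow>
    nested_hyperplane_space (Suc n) {cut_piece v j \<beta> C | C \<beta>. C \<in> \<A>}"

lemma nested_hyperplane_space_length: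
  "nested_hyperplane_space n \<A> \<Longrightarrow> C \<in> \<A> \<Longrightarrow> length C = n"
  by (induction arbitrary: C rule: nested_hyperplane_space.induct) (auto simp: cut_piece_def)

definition ac_prob_measure :: "('a::euclidean_space) measure \<Rightarrow> bool" where
  "ac_prob_measure \<mu> \<longleftrightarrow>
     prob_space \<mu> \<and> sets \<mu> = sets borel \<and> absolutely_continuous lborel \<mu>"

definition envy_free :: "nat \<Rightarrow> (nat \<Rightarrow> 'a measure) \<Rightarrow> 'a set list \<Rightarrow> bool" where
  "envy_free n \<mu> C \<longleftrightarrow>
     (\<exists>\<pi>. \<pi> permutes {..<n} \<and>
       (\<forall>i<n. \<forall>i'<n. measure (\<mu> i) (C ! \<pi> i) \<ge> measure (\<mu> i) (C ! \<pi> i')))"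

end

theory Submission
  imports Defs
begin

text \<open>
  A partition in the space is determined by its \<open>n - 1\<close> cut positions. Rescaled to the unit interval,
  they form a point of a cube, along which every absolutely continuous measure of every piece varies
  continuously, because hyperplanes are null sets. On the two faces belonging to a cut, all pieces on
  one or the other side of this cut are empty
  (\<open>nested_hyperplane_space_has_cut_coordinates\<close>).

  Let each of the \<open>n - 1\<close> known agents spread a unit of weight continuously over its favourite pieces,
  with a small tolerance \<open>\<epsilon>\<close>; empty pieces are never favourites. For each cut, compare the average
  total weight of the pieces on its two sides. By the remark on faces, the Poincare-Miranda theorem
  gives a point where the averages agree at all cuts, and then every piece carries the same weight
  \<open>(n - 1) / n\<close>. As this is less than one, any \<open>s > 0\<close> agents together favour more than \<open>s\<close> pieces.
  By compactness, this persists as \<open>\<epsilon>\<close> tends to zero (\<open>surplus_demand\<close>).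

  Hall's condition thus holds with a surplus of one, so that the known agents can be matched to
  favourite pieces even after an arbitrary piece has been taken away
  (\<open>permutation_with_secret_agent\<close>). Whatever the last measure is, its agent takes the best piece and
  the others are matched to the rest. This proves the second claim, and the first one follows by
  ignoring the last measure when the partition is chosen.
\<close>

section \<open>Common zeros of functions on a cube\<close>

text \<open>
  The dimension of the cube has to vary with the number of pieces, so it cannot be part of the type.
  The cube has infinitely many coordinates instead, and a statement in dimension \<open>n\<close> imposes
  conditions on the first \<open>n\<close> of them only.
\<close>

definition unit_cube :: "(nat \<Rightarrow> real) set" where
  "unit_cube = (\<Pi> i \<in> UNIV. {0..1})"

lemma tendsto_fun_iff:
  fixes u :: "'c \<Rightarrow> 'a \<Rightarrow> 'b::topological_space"
  shows "(u \<longlongrightarrow> l) F \<longleftrightarrow> (\<forall>i. ((\<lambda>c. u c i) \<longlongrightarrow> l i) F)"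
  using limitin_componentwise[of "\<lambda>_. euclidean" UNIV u l F]
  by (simp add: euclidean_product_topology)

lemma compact_unit_cube: "compact unit_cube"
proof -
  have "compactin (product_topology (\<lambda>i::nat. euclidean :: real topology) UNIV)
          (PiE UNIV (\<lambda>_. {0..1::real}))"
    by (simp add: compactin_PiE)
  then show ?thesis
    by (simp add: euclidean_product_topology unit_cube_def PiE_UNIV_domain)
qed

text \<open>
  The Poincare-Miranda theorem. Label the points of a grid coordinatewise by the sign of \<open>F i\<close>. The
  hypotheses on opposite faces are the boundary conditions of Kuhn's combinatorial lemma, which yields
  arbitrarily small grid cells on which each \<open>F i\<close> takes values of both signs. Such cells accumulate
  at a common zero.
\<close>

lemma Poincare_Miranda_unit_cube:
  fixes F :: "nat \<Rightarrow> (nat \<Rightarrow> real) \<Rightarrow> real"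
  assumes cont: "\<And>i. i < n \<Longrightarrow> continuous_on unit_cube (F i)"
    and lower: "\<And>i t. i < n \<Longrightarrow> t \<in> unit_cube \<Longrightarrow> t i = 0 \<Longrightarrow> F i t \<le> 0"
    and upper: "\<And>i t. i < n \<Longrightarrow> t \<in> unit_cube \<Longrightarrow> t i = 1 \<Longrightarrow> F i t \<ge> 0"
  obtains t where "t \<in> unit_cube" "\<And>i. i < n \<Longrightarrow> F i t = 0"
proof -
  define grid :: "nat \<Rightarrow> (nat \<Rightarrow> nat) \<Rightarrow> nat \<Rightarrow> real"
    where "grid m x = (\<lambda>j. if j < n then real (x j) / real (Suc m) else 0)" for m x
  have grid_cube: "grid m x \<in> unit_cube" if "\<And>j. j < n \<Longrightarrow> x j \<le> Suc m" for m x
    using that by (auto simp: grid_def unit_cube_def divide_le_eq simp del: of_nat_Suc)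
  define near :: "(nat \<Rightarrow> nat) \<Rightarrow> (nat \<Rightarrow> nat) \<Rightarrow> bool"
    where "near q x \<longleftrightarrow> (\<forall>j<n. q j \<le> x j \<and> x j \<le> q j + 1)" for q x
  have cell: "\<exists>q. (\<forall>i<n. q i < Suc m) \<and> (\<forall>i<n. \<exists>r s. near q r \<and> near q s \<and>
      F i (grid m r) \<le> 0 \<and> 0 \<le> F i (grid m s))" for m
  proof -
    \<comment> \<open>The faces get the labels that the lemma prescribes, which may differ from the sign only where
      \<open>F i\<close> vanishes.\<close>
    define label :: "(nat \<Rightarrow> nat) \<Rightarrow> nat \<Rightarrow> nat" where "label x i =
      (if x i = 0 then 0 else if x i = Suc m then 1 else if F i (grid m x) \<le> 0 then 0 else 1)" for x i
    have neg: "F i (grid m x) \<le> 0" if "label x i = 0" "i < n" "\<And>j. j < n \<Longrightarrow> x j \<le> Suc m" for x i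
      using that lower[OF that(2) grid_cube[of x m]]
      by (auto simp: label_def grid_def split: if_splits)
    have pos: "F i (grid m x) \<ge> 0" if "label x i \<noteq> 0" "i < n" "\<And>j. j < n \<Longrightarrow> x j \<le> Suc m" for x i
      using that upper[OF that(2) grid_cube[of x m]]
      by (auto simp: label_def grid_def split: if_splits)
    obtain q where q: "\<forall>i<n. q i < Suc m"
      "\<forall>i<n. \<exists>r s. near q r \<and> near q s \<and> label r i \<noteq> label s i"
      by (rule kuhn_lemma[of "Suc m" n label]) (auto simp: label_def near_def)
    show ?thesis
    proof (rule exI[of _ q], intro conjI q(1) allI impI)
      fix i assume i: "i < n"
      then obtain r s where rs: "near q r" "near q s" "label r i \<noteq> label s i"
        using q(2) by blast
      have bd: "r j \<le> Suc m" "s j \<le> Suc m" if "j < n" for j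
        using that rs(1,2) q(1) unfolding near_def by (metis Suc_eq_plus1 Suc_leI le_trans)+
      have "\<exists>r s. near q r \<and> near q s \<and>
        label r i = 0 \<and> label s i \<noteq> 0 \<and> (\<forall>j<n. r j \<le> Suc m) \<and> (\<forall>j<n. s j \<le> Suc m)"
      proof (cases "label r i = 0")
        case True
        then show ?thesis using rs bd by (intro exI[of _ r] exI[of _ s]) auto
      next
        case False
        then have "label s i = 0" using rs(3) by (auto simp: label_def split: if_splits)
        then show ?thesis using False rs bd by (intro exI[of _ s] exI[of _ r]) auto
      qed
      then show "\<exists>r s. near q r \<and> near q s \<and>
        F i (grid m r) \<le> 0 \<and> 0 \<le> F i (grid m s)"
        using neg[OF _ i] pos[OF _ i] by (elim exE conjE) blast
    qed
  qed
  \<comment> \<open>\<open>good\<close> and \<open>pair\<close> only hide the quantifiers while the corners of the cells are chosen.\<close>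
  define pair where "pair m q i r s \<longleftrightarrow>
    near q r \<and> near q s \<and> F i (grid m r) \<le> 0 \<and> 0 \<le> F i (grid m s)" for m q i r s
  define good where "good m q \<longleftrightarrow> (\<forall>i<n. q i < Suc m) \<and> (\<forall>i<n. \<exists>r s. pair m q i r s)" for m q
  have "\<forall>m. \<exists>q. good m q"
    using cell by (simp add: good_def pair_def)
  then obtain Q where good: "\<And>m. good m (Q m)" by metis
  then have q: "\<And>m i. i < n \<Longrightarrow> Q m i < Suc m" by (simp add: good_def)
  have "\<forall>m i. \<exists>r s. i < n \<longrightarrow> pair m (Q m) i r s"
    using good by (simp add: good_def)
  then obtain r s where rs: "\<And>m i. i < n \<Longrightarrow> pair m (Q m) i (r m i) (s m i)" by metis
  have q_cube: "grid m (Q m) \<in> unit_cube" for m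
    using q by (intro grid_cube) (simp add: less_imp_le)
  obtain t \<phi> where t: "t \<in> unit_cube" and \<phi>: "strict_mono \<phi>"
    and lim: "((\<lambda>m. grid m (Q m)) \<circ> \<phi>) \<longlonglongrightarrow> t"
    by (rule seq_compactE[OF compact_imp_seq_compact[OF compact_unit_cube], of "\<lambda>m. grid m (Q m)"])
      (use q_cube in auto)
  have lim_near: "(\<lambda>m. grid (\<phi> m) (x (\<phi> m))) \<longlonglongrightarrow> t"
    if x: "\<And>m. near (Q m) (x m)" for x
    unfolding tendsto_fun_iff
  proof
    fix j
    have diff: "(\<lambda>m. grid (\<phi> m) (x (\<phi> m)) j - grid (\<phi> m) (Q (\<phi> m)) j) \<longlonglongrightarrow> 0"
    proof (rule Lim_null_comparison)
      show "(\<lambda>m. 1 / real (Suc (\<phi> m))) \<longlonglongrightarrow> 0"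
        using LIMSEQ_subseq_LIMSEQ[OF LIMSEQ_inverse_real_of_nat \<phi>]
        by (simp add: o_def divide_inverse)
      show "\<forall>\<^sub>F m in sequentially.
        norm (grid (\<phi> m) (x (\<phi> m)) j - grid (\<phi> m) (Q (\<phi> m)) j) \<le> 1 / real (Suc (\<phi> m))"
      proof (rule always_eventually, rule allI)
        fix m
        show "norm (grid (\<phi> m) (x (\<phi> m)) j - grid (\<phi> m) (Q (\<phi> m)) j) \<le> 1 / real (Suc (\<phi> m))"
        proof (cases "j < n")
          case True
          have "grid (\<phi> m) (x (\<phi> m)) j - grid (\<phi> m) (Q (\<phi> m)) j
              = (real (x (\<phi> m) j) - real (Q (\<phi> m) j)) / real (Suc (\<phi> m))"
            using True by (simp add: grid_def diff_divide_distrib)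
          moreover have "\<bar>real (x (\<phi> m) j) - real (Q (\<phi> m) j)\<bar> \<le> 1"
            using x[of "\<phi> m"] True unfolding near_def by force
          ultimately show ?thesis
            by (simp add: abs_divide divide_right_mono del: of_nat_Suc)
        qed (simp add: grid_def)
      qed
    qed
    have "(\<lambda>m. grid (\<phi> m) (Q (\<phi> m)) j) \<longlonglongrightarrow> t j"
      using lim by (simp add: tendsto_fun_iff o_def)
    from tendsto_add[OF diff this] show "(\<lambda>m. grid (\<phi> m) (x (\<phi> m)) j) \<longlonglongrightarrow> t j"
      by simp
  qed
  have "F i t = 0" if i: "i < n" for i
  proof (rule antisym)
    have lim_F: "(\<lambda>m. F i (grid (\<phi> m) (x (\<phi> m)))) \<longlonglongrightarrow> F i t"
      if x: "\<And>m. near (Q m) (x m)" for x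
    proof -
      have "grid (\<phi> m) (x (\<phi> m)) \<in> unit_cube" for m
        using x[of "\<phi> m"] q unfolding near_def
        by (intro grid_cube) (metis Suc_eq_plus1 Suc_leI le_trans)
      then show ?thesis
        using cont[OF i] lim_near[of x, OF x] t unfolding continuous_on_sequentially by (auto simp: o_def)
    qed
    show "F i t \<le> 0"
      using LIMSEQ_le_const2[OF lim_F[of "\<lambda>m. r m i"]] rs[OF i] by (auto simp: pair_def)
    show "0 \<le> F i t"
      using LIMSEQ_le_const[OF lim_F[of "\<lambda>m. s m i"]] rs[OF i] by (auto simp: pair_def)
  qed
  with t that show thesis by blast
qed

section \<open>Systems of distinct representatives\<close>

text \<open>
  The Halmos-Vaughan induction. If some proper nonempty subset \<open>T\<close> has exactly as many candidates as
  members, match \<open>T\<close> within its candidates; the remaining members still satisfy the condition with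
  those candidates removed. Otherwise every such subset has a candidate to spare, so any single pair
  may be matched first.
\<close>

theorem Hall_marriage:
  assumes "finite I" "\<And>i. i \<in> I \<Longrightarrow> finite (N i)"
    and "\<And>S. S \<subseteq> I \<Longrightarrow> card S \<le> card (\<Union>i\<in>S. N i)"
  shows "\<exists>f. inj_on f I \<and> (\<forall>i\<in>I. f i \<in> N i)"
  using assms
proof (induction "card I" arbitrary: I N rule: less_induct)
  case less
  show ?case
  proof (cases "I = {}")
    case False
    then obtain a where a: "a \<in> I" by auto
    show ?thesis
    proof (cases "\<exists>T. T \<noteq> {} \<and> T \<subset> I \<and> card T = card (\<Union>i\<in>T. N i)")
      case True
      then obtain T where T: "T \<noteq> {}" "T \<subset> I" "card T = card (\<Union>i\<in>T. N i)" by blast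
      let ?U = "\<Union>i\<in>T. N i"
      have finT: "finite T"
        using T(2) less.prems(1) by (meson finite_subset psubset_imp_subset)
      have finU: "finite ?U"
        using T(2) less.prems(2) finT by auto
      have cT: "card T < card I" using T(2) less.prems(1) by (simp add: psubset_card_mono)
      have "\<exists>f. inj_on f T \<and> (\<forall>i\<in>T. f i \<in> N i)"
        using T(2) less.prems by (intro less.hyps cT finT) auto
      then obtain f where f: "inj_on f T" "\<And>i. i \<in> T \<Longrightarrow> f i \<in> N i" by blast
      have "\<exists>g. inj_on g (I - T) \<and> (\<forall>i\<in>I - T. g i \<in> N i - ?U)"
      proof (rule less.hyps)
        show "card (I - T) < card I"
          using T(1,2) finT cT by (intro psubset_card_mono less.prems(1)) auto
        show "finite (I - T)" using less.prems(1) by simp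
        show "finite (N i - ?U)" if "i \<in> I - T" for i using less.prems(2) that by simp
        fix S assume S: "S \<subseteq> I - T"
        have finS: "finite S" using S less.prems(1) finite_subset by blast
        have "card S + card T = card (S \<union> T)"
          using S finS finT by (subst card_Un_disjoint) auto
        also have "\<dots> \<le> card (\<Union>i\<in>S \<union> T. N i)"
          using S T(2) by (intro less.prems(3)) auto
        also have "(\<Union>i\<in>S \<union> T. N i) = (\<Union>i\<in>S. N i - ?U) \<union> ?U" by auto
        also have "card \<dots> = card (\<Union>i\<in>S. N i - ?U) + card T"
        proof -
          have "finite (\<Union>i\<in>S. N i - ?U)" using S finS less.prems(2) by auto
          then show ?thesis using finU T(3) by (subst card_Un_disjoint) auto
        qed
        finally show "card S \<le> card (\<Union>i\<in>S. N i - ?U)" by simp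
      qed
      then obtain g where g: "inj_on g (I - T)" "\<And>i. i \<in> I - T \<Longrightarrow> g i \<in> N i - ?U" by blast
      define h where "h i = (if i \<in> T then f i else g i)" for i
      have "inj_on h I"
      proof (rule inj_onI)
        fix x y assume xy: "x \<in> I" "y \<in> I" "h x = h y"
        show "x = y"
        proof (cases "x \<in> T"; cases "y \<in> T")
          assume "x \<in> T" "y \<in> T"
          then show ?thesis using xy f(1) by (auto simp: h_def inj_on_def)
        next
          assume "x \<notin> T" "y \<notin> T"
          then show ?thesis using xy g(1) by (auto simp: h_def inj_on_def)
        next
          assume A: "x \<in> T" "y \<notin> T"
          then have "g y \<in> ?U" using xy f(2)[of x] by (auto simp: h_def)
          then show ?thesis using g(2)[of y] A xy by blast
        next
          assume A: "x \<notin> T" "y \<in> T"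
          then have "g x \<in> ?U" using xy f(2)[of y] by (auto simp: h_def)
          then show ?thesis using g(2)[of x] A xy by blast
        qed
      qed
      moreover have "\<forall>i\<in>I. h i \<in> N i" using f(2) g(2) by (auto simp: h_def)
      ultimately show ?thesis by blast
    next
      case False
      have "card {a} \<le> card (N a)" using less.prems(3)[of "{a}"] a by simp
      then obtain b where b: "b \<in> N a" by fastforce
      have "\<exists>f. inj_on f (I - {a}) \<and> (\<forall>i\<in>I - {a}. f i \<in> N i - {b})"
      proof (rule less.hyps)
        show "card (I - {a}) < card I" using a by (intro psubset_card_mono less.prems(1)) auto
        show "finite (I - {a})" using less.prems(1) by simp
        show "finite (N i - {b})" if "i \<in> I - {a}" for i using less.prems(2) that by simp
        fix S assume S: "S \<subseteq> I - {a}"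
        show "card S \<le> card (\<Union>i\<in>S. N i - {b})"
        proof (cases "S = {}")
          case ne: False
          have "S \<subset> I" using S a by blast
          then have "card S < card (\<Union>i\<in>S. N i)"
            using ne False less.prems(3)[of S] by (metis le_neq_implies_less psubset_imp_subset)
          moreover have "(\<Union>i\<in>S. N i - {b}) = (\<Union>i\<in>S. N i) - {b}" by auto
          ultimately show ?thesis by (auto simp: card_Diff_singleton_if)
        qed simp
      qed
      then obtain f where f: "inj_on f (I - {a})" "\<And>i. i \<in> I - {a} \<Longrightarrow> f i \<in> N i - {b}" by blast
      have "inj_on (f(a := b)) I" using f a by (fastforce simp: inj_on_def)
      moreover have "\<forall>i\<in>I. (f(a := b)) i \<in> N i" using f(2) b by auto
      ultimately show ?thesis by blast
    qed
  qed simp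
qed

section \<open>Pieces of nested hyperplane partitions\<close>

lemma nth_cut_piece:
  assumes "length C = n" "j < n" "i \<le> n"
  shows "cut_piece v j \<beta> C ! i = C ! (if i \<le> j then i else i - 1) \<inter>
    (if i = j then {y. ereal (y \<bullet> v) \<ge> \<beta>} else if i = Suc j then {y. ereal (y \<bullet> v) \<le> \<beta>} else UNIV)"
proof -
  consider "i < j" | "i = j" | "i = Suc j" | m where "i = j + 2 + m"
    by (metis add_2_eq_Suc' le_Suc_ex less_antisym not_less_eq not_less nat_less_le Suc_leI)
  then show ?thesis
    using assms by cases (auto simp: cut_piece_def nth_append)
qed

lemma closed_nested_piece:
  assumes "nested_hyperplane_space n \<A>" "C \<in> \<A>" "i < n"
  shows "closed (C ! i)"
  using assms
proof (induction arbitrary: C i rule: nested_hyperplane_space.induct)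
  case (cut n \<A> v j)
  then obtain C' \<beta> where C: "C = cut_piece v j \<beta> C'" "C' \<in> \<A>" by auto
  have "closed {y. ereal (y \<bullet> v) \<ge> \<beta>}" "closed {y. ereal (y \<bullet> v) \<le> \<beta>}"
    by (intro closed_Collect_le continuous_intros)+
  then show ?case
    using cut C nested_hyperplane_space_length[OF cut.hyps(1) C(2)]
    by (auto simp: nth_cut_piece intro!: closed_Int)
qed auto

lemma nested_pieces_cover:
  assumes "nested_hyperplane_space n \<A>" "C \<in> \<A>"
  shows "\<exists>i<n. y \<in> C ! i"
  using assms
proof (induction arbitrary: C rule: nested_hyperplane_space.induct)
  case (cut n \<A> v j)
  then obtain C' \<beta> where C: "C = cut_piece v j \<beta> C'" "C' \<in> \<A>" by auto
  note len = nested_hyperplane_space_length[OF cut.hyps(1) C(2)]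
  obtain i where i: "i < n" "y \<in> C' ! i" using cut.IH[OF C(2)] by auto
  consider "i < j" | "i = j" "ereal (y \<bullet> v) \<ge> \<beta>" | "i = j" "ereal (y \<bullet> v) \<le> \<beta>" | "i > j"
    using linear by (metis linorder_neqE_nat)
  then show ?case
  proof cases
    case 1
    then show ?thesis using i cut.hyps len by (intro exI[of _ i]) (auto simp: C nth_cut_piece)
  next
    case 2
    then show ?thesis using i cut.hyps len by (intro exI[of _ i]) (auto simp: C nth_cut_piece)
  next
    case 3
    then show ?thesis using i cut.hyps len by (intro exI[of _ "Suc i"]) (auto simp: C nth_cut_piece)
  next
    case 4
    then show ?thesis using i cut.hyps len by (intro exI[of _ "Suc i"]) (auto simp: C nth_cut_piece)
  qed
qed auto

section \<open>Parametrizing a space of partitions by a cube\<close>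

text \<open>
  The inverse of the decreasing bijection \<open>x \<mapsto> 1 / (1 + exp x)\<close> from the reals onto the open unit
  interval, extended to the endpoints by the two limiting positions. It turns a condition on an
  extended real cut position into one on a real number in the unit interval: see
  \<open>cut_position_le_iff\<close> and \<open>le_cut_position_iff\<close>. It decreases so that parameter 0 empties the first
  of the two new pieces.
\<close>

definition cut_position :: "real \<Rightarrow> ereal" where
  "cut_position s = (if s \<le> 0 then \<infinity> else if 1 \<le> s then -\<infinity> else ereal (ln (1 / s - 1)))"

definition sigmoid :: "real \<Rightarrow> real" where
  "sigmoid x = 1 / (1 + exp x)"

lemma sigmoid_bounds: "0 < sigmoid x" "sigmoid x < 1"
  by (auto simp: sigmoid_def add_pos_pos)

lemma sigmoid_less_iff: 
  assumes "0 < s" "s < 1"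
  shows "sigmoid x < s \<longleftrightarrow> ln (1 / s - 1) < x" "s < sigmoid x \<longleftrightarrow> x < ln (1 / s - 1)"
proof -
  have p: "1 / s - 1 > 0" using assms by (simp add: field_simps)
  have e: "1 + exp x > 0" by (simp add: add_pos_pos)
  have "sigmoid x < s \<longleftrightarrow> 1 / s - 1 < exp x"
    using assms e by (simp add: sigmoid_def field_simps)
  then show "sigmoid x < s \<longleftrightarrow> ln (1 / s - 1) < x"
    using p by (metis exp_less_cancel_iff exp_ln)
  have "s < sigmoid x \<longleftrightarrow> exp x < 1 / s - 1"
    using assms e by (simp add: sigmoid_def field_simps)
  then show "s < sigmoid x \<longleftrightarrow> x < ln (1 / s - 1)"
    using p by (metis exp_less_cancel_iff exp_ln)
qed

lemma cut_position_le_iff: "cut_position s \<le> ereal x \<longleftrightarrow> sigmoid x \<le> s"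
  using sigmoid_bounds[of x] sigmoid_less_iff(2)[of s x] by (auto simp: cut_position_def)

lemma le_cut_position_iff: "ereal x \<le> cut_position s \<longleftrightarrow> s \<le> sigmoid x"
  using sigmoid_bounds[of x] sigmoid_less_iff(1)[of s x] by (auto simp: cut_position_def)

lemma AE_lborel_not_on_hyperplane:
  fixes v :: "'a::euclidean_space"
  assumes "v \<noteq> 0"
  shows "AE y in lborel. y \<bullet> v \<noteq> c"
proof -
  have "{y. v \<bullet> y = c} \<in> null_sets (completion lborel)"
    using negligible_hyperplane[of v c] assms by (simp add: negligible_iff_null_sets)
  moreover have "{y. v \<bullet> y = c} \<in> sets lborel"
    using closed_hyperplane[of v c] by (simp add: borel_closed)
  ultimately have "{y. v \<bullet> y = c} \<in> null_sets lborel"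
    by (simp add: null_sets_completion_iff)
  then show ?thesis
    by (rule AE_I') (auto simp: inner_commute)
qed

text \<open>
  A point off the limiting hyperplane ends up on the correct side of the moving one, and hyperplanes
  are null sets. At a limiting position there is no hyperplane at all: then the logarithm below takes
  some default value, which only discards a harmless null set.
\<close>

lemma AE_eventually_same_side:
  fixes v :: "'a::euclidean_space"
  assumes "v \<noteq> 0" and u: "u \<longlonglongrightarrow> s"
  shows "AE y in lborel. \<forall>\<^sub>F m in sequentially.
    (cut_position (u m) \<le> ereal (y \<bullet> v) \<longleftrightarrow> cut_position s \<le> ereal (y \<bullet> v)) \<and>
    (ereal (y \<bullet> v) \<le> cut_position (u m) \<longleftrightarrow> ereal (y \<bullet> v) \<le> cut_position s)"
  using AE_lborel_not_on_hyperplane[OF assms(1), of "ln (1 / s - 1)"]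
proof (rule eventually_mono)
  fix y assume y: "y \<bullet> v \<noteq> ln (1 / s - 1)"
  have "sigmoid (y \<bullet> v) \<noteq> s"
    using y sigmoid_less_iff[of s "y \<bullet> v"] sigmoid_bounds[of "y \<bullet> v"] by fastforce
  then consider "s < sigmoid (y \<bullet> v)" | "sigmoid (y \<bullet> v) < s" by linarith
  then show "\<forall>\<^sub>F m in sequentially.
    (cut_position (u m) \<le> ereal (y \<bullet> v) \<longleftrightarrow> cut_position s \<le> ereal (y \<bullet> v)) \<and>
    (ereal (y \<bullet> v) \<le> cut_position (u m) \<longleftrightarrow> ereal (y \<bullet> v) \<le> cut_position s)"
  proof cases
    case 1
    then show ?thesis
      using order_tendstoD(2)[OF u 1]
      by (auto simp: cut_position_le_iff le_cut_position_iff elim: eventually_mono)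
  next
    case 2
    then show ?thesis
      using order_tendstoD(1)[OF u 2]
      by (auto simp: cut_position_le_iff le_cut_position_iff elim: eventually_mono)
  qed
qed

text \<open>
  Cutting piece \<open>j\<close> shifts the later pieces; this map sends the index of a new piece to the index of
  the old piece that contains it.
\<close>

definition merge_index :: "nat \<Rightarrow> nat \<Rightarrow> nat" where
  "merge_index j i = (if i \<le> j then i else i - 1)"

text \<open>
  The cuts form a binary tree with the pieces as leaves; \<open>L k\<close> and \<open>R k\<close> are the pieces on the two
  sides of cut \<open>k\<close>. The second conjunct is the one use made of the tree: a weighting whose ratio to a
  reference weighting \<open>a\<close> agrees on the two sides of every cut has a constant ratio to \<open>a\<close>. Only
  constant \<open>a\<close> matters in the end, but merging two leaves adds up their reference weights, so that the
  induction over the tree needs all positive \<open>a\<close>.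
\<close>

definition balance_system :: "nat \<Rightarrow> (nat \<Rightarrow> nat set) \<Rightarrow> (nat \<Rightarrow> nat set) \<Rightarrow> bool" where
  "balance_system n L R \<longleftrightarrow>
    (\<forall>k<n - 1. L k \<subseteq> {..<n} \<and> R k \<subseteq> {..<n}) \<and>
    (\<forall>a w. (\<forall>i<n. a i > (0::real)) \<longrightarrow>
      (\<forall>k<n - 1. sum w (L k) * sum a (R k) = sum w (R k) * sum a (L k)) \<longrightarrow>
      (\<exists>c. \<forall>i<n. w i = c * a i))"

text \<open>
  The sides of the cuts after a cut into \<open>n + 1\<close> pieces: the new cut, which has index \<open>n - 1\<close>, has the
  single piece \<open>new\<close> on the side considered.
\<close>

definition refine_sides :: "nat \<Rightarrow> nat \<Rightarrow> nat \<Rightarrow> (nat \<Rightarrow> nat set) \<Rightarrow> nat \<Rightarrow> nat set" where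
  "refine_sides n j new S k = (if k = n - 1 then {new} else {i. i \<le> n \<and> merge_index j i \<in> S k})"

text \<open>
  Merging the two newest leaves turns weightings on the new tree into weightings on the old one, which
  has the property by assumption. Balance at the new cut then splits the merged weight in the right
  proportion.
\<close>

lemma balance_system_refine:
  assumes bal: "balance_system n L R" and j: "j < n"
  shows "balance_system (Suc n) (refine_sides n j j L) (refine_sides n j (Suc j) R)"
  unfolding balance_system_def
proof (intro conjI allI impI)
  fix k assume "k < Suc n - 1"
  show "refine_sides n j j L k \<subseteq> {..<Suc n}" "refine_sides n j (Suc j) R k \<subseteq> {..<Suc n}"
    using j by (auto simp: refine_sides_def)
next
  fix a w :: "nat \<Rightarrow> real"
  assume a: "\<forall>i<Suc n. a i > 0"
    and eq: "\<forall>k<Suc n - 1. sum w (refine_sides n j j L k) * sum a (refine_sides n j (Suc j) R k)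
      = sum w (refine_sides n j (Suc j) R k) * sum a (refine_sides n j j L k)"
  define merged :: "(nat \<Rightarrow> real) \<Rightarrow> nat \<Rightarrow> real"
    where "merged f l = sum f {i. i \<le> n \<and> merge_index j i = l}" for f l
  have sum_merged: "sum f {i. i \<le> n \<and> merge_index j i \<in> S} = sum (merged f) S" if "S \<subseteq> {..<n}" for f S
  proof -
    have fin: "finite S" using that finite_subset by blast
    have "sum (merged f) S = (\<Sum>l\<in>S. sum f {i \<in> {i. i \<le> n \<and> merge_index j i \<in> S}. merge_index j i = l})"
      unfolding merged_def by (intro sum.cong refl arg_cong2[where f = sum]) auto
    also have "\<dots> = sum f {i. i \<le> n \<and> merge_index j i \<in> S}"
      using fin by (intro sum.group) auto
    finally show ?thesis by simp
  qed
  have fibre: "{i. i \<le> n \<and> merge_index j i = l} =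
    (if l < j then {l} else if l = j then {j, Suc j} else {Suc l})" if "l < n" for l
    using that j by (auto simp: merge_index_def split: if_splits)
  have "\<forall>i<n. merged a i > 0"
    using a by (auto simp: merged_def fibre intro!: add_pos_pos)
  moreover have "\<forall>k<n - 1. sum (merged w) (L k) * sum (merged a) (R k)
      = sum (merged w) (R k) * sum (merged a) (L k)"
  proof (intro allI impI)
    fix k assume k: "k < n - 1"
    then have "L k \<subseteq> {..<n}" "R k \<subseteq> {..<n}" using bal by (auto simp: balance_system_def)
    then show "sum (merged w) (L k) * sum (merged a) (R k)
      = sum (merged w) (R k) * sum (merged a) (L k)"
      using eq[rule_format, of k] k by (simp add: refine_sides_def sum_merged)
  qed
  ultimately obtain c where c: "\<forall>i<n. merged w i = c * merged a i"
    using bal unfolding balance_system_def by blast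
  have pair: "w j + w (Suc j) = c * (a j + a (Suc j))"
    using c[rule_format, OF j] j by (simp add: merged_def fibre)
  have cross: "w j * a (Suc j) = w (Suc j) * a j"
    using eq[rule_format, of "n - 1"] j by (simp add: refine_sides_def)
  have pos: "a j + a (Suc j) > 0" using a j by (intro add_pos_pos) auto
  have wj: "w j = c * a j"
  proof -
    have "(a j + a (Suc j)) * w j = (a j + a (Suc j)) * (c * a j)"
      using pair cross by algebra
    then show ?thesis using pos by simp
  qed
  moreover have "w (Suc j) = c * a (Suc j)"
    using pair wj by (simp add: algebra_simps)
  moreover have "w i = c * a i" if "i < j" for i
    using c[rule_format, of i] that j by (simp add: merged_def fibre)
  moreover have "w i = c * a i" if "i > Suc j" "i < Suc n" for i
  proof -
    obtain l where "i = Suc l" "j < l" "l < n" using \<open>i > Suc j\<close> \<open>i < Suc n\<close> by (cases i) auto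
    then show ?thesis using c[rule_format, of l] by (simp add: merged_def fibre)
  qed
  ultimately show "\<exists>c. \<forall>i<Suc n. w i = c * a i"
    by (metis linorder_neqE_nat not_less_eq)
qed

text \<open>
  A parametrization \<open>\<Phi>\<close> by cut positions. At the endpoints of its range a coordinate empties all
  pieces on one side of its cut. Continuity is expressed by almost everywhere convergence of indicator
  functions, which holds for all absolutely continuous measures at once and, unlike convergence of the
  measures of the pieces, survives intersection with a half-space.
\<close>

definition cut_coordinates ::
    "nat \<Rightarrow> 'a::euclidean_space set list set \<Rightarrow> (nat \<Rightarrow> nat set) \<Rightarrow> (nat \<Rightarrow> nat set) \<Rightarrow>
      ((nat \<Rightarrow> real) \<Rightarrow> 'a set list) \<Rightarrow> bool" where
  "cut_coordinates n \<A> L R \<Phi> \<longleftrightarrow>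
    balance_system n L R \<and> (\<forall>t. \<Phi> t \<in> \<A>) \<and>
    (\<forall>t. \<forall>k<n - 1. t k \<le> 0 \<longrightarrow> (\<forall>i\<in>L k. \<Phi> t ! i = {})) \<and>
    (\<forall>t. \<forall>k<n - 1. 1 \<le> t k \<longrightarrow> (\<forall>i\<in>R k. \<Phi> t ! i = {})) \<and>
    (\<forall>u t. u \<longlonglongrightarrow> t \<longrightarrow>
      (AE y in lborel. \<forall>\<^sub>F m in sequentially. \<forall>i<n. y \<in> \<Phi> (u m) ! i \<longleftrightarrow> y \<in> \<Phi> t ! i))"

lemma cut_coordinatesD:
  assumes "cut_coordinates n \<A> L R \<Phi>"
  shows "balance_system n L R" "\<Phi> t \<in> \<A>"
    and "k < n - 1 \<Longrightarrow> t k \<le> 0 \<Longrightarrow> i \<in> L k \<Longrightarrow> \<Phi> t ! i = {}"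
    and "k < n - 1 \<Longrightarrow> 1 \<le> t k \<Longrightarrow> i \<in> R k \<Longrightarrow> \<Phi> t ! i = {}"
    and "u \<longlonglongrightarrow> t \<Longrightarrow>
      AE y in lborel. \<forall>\<^sub>F m in sequentially. \<forall>i<n. y \<in> \<Phi> (u m) ! i \<longleftrightarrow> y \<in> \<Phi> t ! i"
  using assms unfolding cut_coordinates_def by simp_all

lemma nested_hyperplane_space_has_cut_coordinates:
  assumes "nested_hyperplane_space n \<A>"
  shows "\<exists>\<Phi> L R. cut_coordinates n \<A> L R \<Phi>"
  using assms
proof (induction rule: nested_hyperplane_space.induct)
  case single
  have "balance_system 1 (\<lambda>_. {}) (\<lambda>_. {})"
    unfolding balance_system_def
  proof (intro conjI allI impI)
    fix a w :: "nat \<Rightarrow> real" assume "\<forall>i<1. a i > 0"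
    then show "\<exists>c. \<forall>i<1. w i = c * a i"
      by (intro exI[of _ "w 0 / a 0"]) auto
  qed auto
  then show ?case
    by (intro exI[of _ "\<lambda>_. [UNIV]"] exI[of _ "\<lambda>_. {}"]) (auto simp: cut_coordinates_def)
next
  case (cut n \<A> v j)
  then obtain \<Phi> L R where \<Phi>: "cut_coordinates n \<A> L R \<Phi>" by blast
  note bal = cut_coordinatesD(1)[OF \<Phi>] and in_space = cut_coordinatesD(2)[OF \<Phi>]
    and left = cut_coordinatesD(3)[OF \<Phi>] and right = cut_coordinatesD(4)[OF \<Phi>]
    and lim = cut_coordinatesD(5)[OF \<Phi>]
  have v: "v \<noteq> 0" using cut.hyps by auto
  define \<Psi> where "\<Psi> t = cut_piece v j (cut_position (t (n - 1))) (\<Phi> t)" for t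
  have \<Psi>: "\<Psi> t ! i = \<Phi> t ! merge_index j i \<inter>
    (if i = j then {y. cut_position (t (n - 1)) \<le> ereal (y \<bullet> v)}
     else if i = Suc j then {y. ereal (y \<bullet> v) \<le> cut_position (t (n - 1))} else UNIV)"
    if "i \<le> n" for i t
    using nth_cut_piece[OF nested_hyperplane_space_length[OF cut.hyps(1) in_space] \<open>j < n\<close> that]
    by (simp add: \<Psi>_def merge_index_def)
  have "cut_coordinates (Suc n) {cut_piece v j \<beta> C |C \<beta>. C \<in> \<A>}
      (refine_sides n j j L) (refine_sides n j (Suc j) R) \<Psi>"
    unfolding cut_coordinates_def
  proof (intro conjI allI impI ballI)
    show "balance_system (Suc n) (refine_sides n j j L) (refine_sides n j (Suc j) R)"
      using bal cut.hyps by (intro balance_system_refine) auto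
    show "\<Psi> t \<in> {cut_piece v j \<beta> C |C \<beta>. C \<in> \<A>}" for t
      using in_space by (auto simp: \<Psi>_def)
    show "\<Psi> t ! i = {}" if "k < Suc n - 1" "t k \<le> 0" "i \<in> refine_sides n j j L k" for t k i
    proof (cases "k = n - 1")
      case True
      then show ?thesis using that cut.hyps by (simp add: refine_sides_def \<Psi> cut_position_def)
    next
      case False
      then show ?thesis using that left[of k t "merge_index j i"] by (simp add: refine_sides_def \<Psi>)
    qed
    show "\<Psi> t ! i = {}" if "k < Suc n - 1" "1 \<le> t k" "i \<in> refine_sides n j (Suc j) R k" for t k i
    proof (cases "k = n - 1")
      case True
      then show ?thesis using that cut.hyps by (simp add: refine_sides_def \<Psi> cut_position_def)
    next
      case False
      then show ?thesis using that right[of k t "merge_index j i"] by (simp add: refine_sides_def \<Psi>)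
    qed
    fix u and t :: "nat \<Rightarrow> real" assume u: "u \<longlonglongrightarrow> t"
    have "(\<lambda>m. u m (n - 1)) \<longlonglongrightarrow> t (n - 1)"
      using u by (simp add: tendsto_fun_iff)
    from lim[OF u] AE_eventually_same_side[OF v this]
    show "AE y in lborel. \<forall>\<^sub>F m in sequentially. \<forall>i<Suc n. y \<in> \<Psi> (u m) ! i \<longleftrightarrow> y \<in> \<Psi> t ! i"
    proof eventually_elim
      case (elim y)
      then show ?case
      proof eventually_elim
        case (elim m)
        have "merge_index j i < n" if "i \<le> n" for i
          using that \<open>j < n\<close> by (auto simp: merge_index_def)
        then show ?case using elim by (auto simp: less_Suc_eq_le \<Psi>)
      qed
    qed
  qed
  then show ?case by blast
qed

text \<open>
  The exceptional null set is also null for \<open>\<mu>\<close>, so this is dominated convergence of the indicator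
  functions.
\<close>

lemma tendsto_measure_of_AE_eventually:
  assumes "ac_prob_measure \<mu>" and closed: "\<And>m. closed (A m)" "closed B"
    and lim: "AE y in lborel. \<forall>\<^sub>F m in sequentially. y \<in> A m \<longleftrightarrow> y \<in> B"
  shows "(\<lambda>m. measure \<mu> (A m)) \<longlonglongrightarrow> measure \<mu> B"
proof -
  interpret prob_space \<mu> using assms by (simp add: ac_prob_measure_def)
  have sets: "sets \<mu> = sets borel" and ac: "absolutely_continuous lborel \<mu>"
    using assms by (auto simp: ac_prob_measure_def)
  have [measurable]: "A m \<in> sets \<mu>" "B \<in> sets \<mu>" for m
    using closed by (auto simp: sets borel_closed)
  have "AE y in \<mu>. \<forall>\<^sub>F m in sequentially. y \<in> A m \<longleftrightarrow> y \<in> B"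
    using lim ac sets by (intro absolutely_continuous_AE[OF _ _ lim]) auto
  then have AE: "AE y in \<mu>. (\<lambda>m. indicator (A m) y :: real) \<longlonglongrightarrow> indicator B y"
  proof eventually_elim
    case (elim y)
    then show ?case
      by (intro tendsto_eventually) (auto elim!: eventually_mono simp: indicator_def)
  qed
  have "(\<lambda>m. \<integral>y. indicator (A m) y \<partial>\<mu>) \<longlonglongrightarrow> (\<integral>y. indicator B y \<partial>\<mu> :: real)"
    by (rule integral_dominated_convergence[where w = "\<lambda>_. 1"]) (use AE in auto)
  then show ?thesis by simp
qed

section \<open>Points of the cube at which demand is spread out\<close>

lemma balanced_weights_const:
  assumes "balance_system n L R"
    and "\<And>k. k < n - 1 \<Longrightarrow> sum w (L k) * real (card (R k)) = sum w (R k) * real (card (L k))"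
  obtains c where "\<And>i. i < n \<Longrightarrow> w i = c"
proof -
  have *: "(\<forall>k<n - 1. sum w (L k) * sum a (R k) = sum w (R k) * sum a (L k)) \<Longrightarrow>
      \<exists>c. \<forall>i<n. w i = c * a i" if "\<forall>i<n. a i > 0" for a :: "nat \<Rightarrow> real"
    using assms(1) that unfolding balance_system_def by blast
  show thesis using *[of "\<lambda>_. 1"] assms(2) that by auto
qed

text \<open>
  Here \<open>f i k t\<close> is the value of piece \<open>k\<close> for agent \<open>i\<close> at the point \<open>t\<close>. Each agent distributes a
  unit of weight continuously over the pieces within \<open>\<epsilon>\<close> of its favourite. As \<open>\<epsilon> < 1 / n\<close>, worthless
  pieces get nothing, so the weights on the two sides of a cut have the signs on opposite faces that
  the Poincare-Miranda theorem asks for, and at some point all pieces carry the same total weight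
  \<open>(n - 1) / n\<close>. There the agents in \<open>S\<close> place weight \<open>card S\<close> on pieces that hold less than one
  unit each, so they need more than \<open>card S\<close> pieces.
\<close>

lemma approximate_surplus_demand:
  fixes f :: "nat \<Rightarrow> nat \<Rightarrow> (nat \<Rightarrow> real) \<Rightarrow> real"
  assumes n: "n > 0" and bal: "balance_system n L R" and \<epsilon>: "0 < \<epsilon>" "\<epsilon> < 1 / n"
    and cont: "\<And>i k. i < n - 1 \<Longrightarrow> k < n \<Longrightarrow> continuous_on unit_cube (f i k)"
    and total: "\<And>i t. i < n - 1 \<Longrightarrow> t \<in> unit_cube \<Longrightarrow> (\<Sum>k<n. f i k t) \<ge> 1"
    and left: "\<And>i j k t. i < n - 1 \<Longrightarrow> t \<in> unit_cube \<Longrightarrow> j < n - 1 \<Longrightarrow> t j = 0 \<Longrightarrow> k \<in> L j \<Longrightarrow> f i k t = 0"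
    and right: "\<And>i j k t. i < n - 1 \<Longrightarrow> t \<in> unit_cube \<Longrightarrow> j < n - 1 \<Longrightarrow> t j = 1 \<Longrightarrow> k \<in> R j \<Longrightarrow> f i k t = 0"
  obtains t where "t \<in> unit_cube"
    "\<And>S. S \<subseteq> {..<n - 1} \<Longrightarrow> S \<noteq> {} \<Longrightarrow> card S < card (\<Union>i\<in>S. {k. k < n \<and> (\<forall>l<n. f i l t < f i k t + \<epsilon>)})"
proof -
  \<comment> \<open>A product rather than a comparison with the maximum: a continuous function that is positive
    exactly if piece \<open>k\<close> is within \<open>\<epsilon>\<close> of every other piece.\<close>
  define h where "h i k t = (\<Prod>l<n. max 0 (f i k t - f i l t + \<epsilon>))" for i k t
  define H where "H i t = (\<Sum>k<n. h i k t)" for i t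
  define g where "g i k t = h i k t / H i t" for i k t
  define w where "w t k = (\<Sum>i<n - 1. g i k t)" for t k
  have LR: "L j \<subseteq> {..<n}" "R j \<subseteq> {..<n}" if "j < n - 1" for j
    using bal that by (auto simp: balance_system_def)
  have h_nonneg: "h i k t \<ge> 0" for i k t
    unfolding h_def by (intro prod_nonneg) auto
  have H_pos: "H i t > 0" for i t
  proof -
    have "Max ((\<lambda>k. f i k t) ` {..<n}) \<in> (\<lambda>k. f i k t) ` {..<n}"
      using n by (intro Max_in) auto
    then obtain k where k: "k < n" "f i k t = Max ((\<lambda>k. f i k t) ` {..<n})" by auto
    have "f i l t \<le> f i k t" if "l < n" for l
      unfolding k(2) using that by (intro Max_ge) auto
    then have "h i k t > 0"
      unfolding h_def using \<epsilon> by (intro prod_pos) (force simp: less_max_iff_disj)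
    also have "h i k t \<le> H i t"
      unfolding H_def using k(1) h_nonneg by (intro member_le_sum) auto
    finally show ?thesis .
  qed
  have g_nonneg: "g i k t \<ge> 0" for i k t
    using h_nonneg[of i k t] H_pos[of i t] by (simp add: g_def)
  have g_sum: "(\<Sum>k<n. g i k t) = 1" for i t
    using H_pos[of i t] by (simp add: g_def H_def flip: sum_divide_distrib)
  have g_demand: "\<forall>l<n. f i l t < f i k t + \<epsilon>" if "g i k t \<noteq> 0" for i k t
  proof (intro allI impI, rule ccontr)
    fix l assume "l < n" "\<not> f i l t < f i k t + \<epsilon>"
    then have "h i k t = 0" unfolding h_def by (intro prod_zero) (auto intro!: bexI[of _ l])
    then show False using that by (simp add: g_def)
  qed
  have g_zero: "g i k t = 0" if "f i k t = 0" "i < n - 1" "t \<in> unit_cube" for i k t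
  proof (rule ccontr)
    assume "g i k t \<noteq> 0"
    then have "f i l t < \<epsilon>" if "l < n" for l
      using g_demand[of i k t] \<open>f i k t = 0\<close> that by auto
    then have "(\<Sum>l<n. f i l t) \<le> (\<Sum>l<n. \<epsilon>)" by (intro sum_mono) (auto intro: less_imp_le)
    also have "\<dots> < 1" using \<epsilon> n by (simp add: field_simps)
    finally show False using total[OF that(2,3)] by simp
  qed
  have cont_h: "continuous_on unit_cube (h i k)" if "i < n - 1" "k < n" for i k
    unfolding h_def using cont that by (intro continuous_intros) auto
  have cont_w: "continuous_on unit_cube (\<lambda>t. w t k)" if "k < n" for k
    unfolding w_def g_def H_def
  proof (intro continuous_on_sum continuous_on_divide ballI)
    fix i t assume "i \<in> {..<n - 1}"
    show "(\<Sum>k<n. h i k t) \<noteq> 0" using H_pos[of i t] by (simp add: H_def)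
  qed (use cont_h that in auto)
  define F where "F j t = sum (w t) (L j) * real (card (R j)) - sum (w t) (R j) * real (card (L j))" for j t
  have w_nonneg: "w t k \<ge> 0" for t k unfolding w_def by (intro sum_nonneg g_nonneg)
  obtain t where t: "t \<in> unit_cube" and F0: "\<And>j. j < n - 1 \<Longrightarrow> F j t = 0"
  proof (rule Poincare_Miranda_unit_cube[of "n - 1" F])
    fix j assume j: "j < n - 1"
    show "continuous_on unit_cube (F j)"
      unfolding F_def using LR[OF j] cont_w by (intro continuous_intros) auto
    fix t assume t: "t \<in> unit_cube"
    show "F j t \<le> 0" if "t j = 0"
    proof -
      have "sum (w t) (L j) = 0"
        unfolding w_def using g_zero left[OF _ t j that] t by (intro sum.neutral ballI) auto
      then show ?thesis by (simp add: F_def sum_nonneg w_nonneg)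
    qed
    show "F j t \<ge> 0" if "t j = 1"
    proof -
      have "sum (w t) (R j) = 0"
        unfolding w_def using g_zero right[OF _ t j that] t by (intro sum.neutral ballI) auto
      then show ?thesis by (simp add: F_def sum_nonneg w_nonneg)
    qed
  qed auto
  obtain c where c: "\<And>k. k < n \<Longrightarrow> w t k = c"
    using balanced_weights_const[OF bal, of "w t"] F0 by (force simp: F_def)
  have "(\<Sum>k<n. w t k) = real (n - 1)"
    unfolding w_def by (subst sum.swap) (simp add: g_sum)
  then have "real n * c = real n - 1" using n c by (simp add: of_nat_diff)
  then have c1: "c < 1"
    using n by (metis less_add_one diff_less_eq mult.right_neutral mult_less_cancel_left_pos of_nat_0_less_iff)
  show thesis
  proof (rule that[OF t])
    fix S assume S: "S \<subseteq> {..<n - 1}" "S \<noteq> {}"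
    define N where "N = (\<Union>i\<in>S. {k. k < n \<and> (\<forall>l<n. f i l t < f i k t + \<epsilon>)})"
    have finS: "finite S" using S(1) finite_subset by blast
    have N: "N \<subseteq> {..<n}" by (auto simp: N_def)
    have "real (card S) = (\<Sum>i\<in>S. \<Sum>k<n. g i k t)" by (simp add: g_sum)
    also have "\<dots> = (\<Sum>i\<in>S. \<Sum>k\<in>N. g i k t)"
      using N g_demand by (intro sum.cong refl sum.mono_neutral_right) (auto simp: N_def)
    also have "\<dots> \<le> (\<Sum>i<n - 1. \<Sum>k\<in>N. g i k t)"
      using S(1) g_nonneg by (intro sum_mono2 sum_nonneg) auto
    also have "\<dots> = (\<Sum>k\<in>N. w t k)" unfolding w_def by (rule sum.swap)
    also have "\<dots> = real (card N) * c" using c N by (simp add: subset_iff)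
    finally have le: "real (card S) \<le> real (card N) * c" .
    moreover have "card S > 0" using S finS by (simp add: card_gt_0_iff)
    ultimately have "card N > 0" by (cases "card N") auto
    then have "real (card N) * c < real (card N)" using c1 by simp
    then show "card S < card N" using le by linarith
  qed
qed

text \<open>
  The limit \<open>\<epsilon> \<longlonglongrightarrow> 0\<close>: at an accumulation point of approximate solutions, a piece that is not a
  favourite falls short by a fixed amount, and so it is not a near-favourite at late approximate
  solutions. The demand sets there are contained in those of the limit.
\<close>

lemma surplus_demand:
  fixes f :: "nat \<Rightarrow> nat \<Rightarrow> (nat \<Rightarrow> real) \<Rightarrow> real"
  assumes n: "n > 0" and bal: "balance_system n L R"
    and cont: "\<And>i k. i < n - 1 \<Longrightarrow> k < n \<Longrightarrow> continuous_on unit_cube (f i k)"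
    and total: "\<And>i t. i < n - 1 \<Longrightarrow> t \<in> unit_cube \<Longrightarrow> (\<Sum>k<n. f i k t) \<ge> 1"
    and left: "\<And>i j k t. i < n - 1 \<Longrightarrow> t \<in> unit_cube \<Longrightarrow> j < n - 1 \<Longrightarrow> t j = 0 \<Longrightarrow> k \<in> L j \<Longrightarrow> f i k t = 0"
    and right: "\<And>i j k t. i < n - 1 \<Longrightarrow> t \<in> unit_cube \<Longrightarrow> j < n - 1 \<Longrightarrow> t j = 1 \<Longrightarrow> k \<in> R j \<Longrightarrow> f i k t = 0"
  obtains t where "t \<in> unit_cube"
    "\<And>S. S \<subseteq> {..<n - 1} \<Longrightarrow> S \<noteq> {} \<Longrightarrow> card S < card (\<Union>i\<in>S. {k. k < n \<and> (\<forall>l<n. f i l t \<le> f i k t)})"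
proof -
  define \<epsilon> where "\<epsilon> m = 1 / real (Suc (n + m))" for m
  define near where "near m t i = {k. k < n \<and> (\<forall>l<n. f i l t < f i k t + \<epsilon> m)}" for m t i
  have "\<exists>t. t \<in> unit_cube \<and> (\<forall>S. S \<subseteq> {..<n - 1} \<longrightarrow> S \<noteq> {} \<longrightarrow> card S < card (\<Union>i\<in>S. near m t i))" for m
  proof (rule approximate_surplus_demand[of n L R "\<epsilon> m" f, OF n bal _ _ cont total left right])
    show "0 < \<epsilon> m" "\<epsilon> m < 1 / real n" using n by (auto simp: \<epsilon>_def intro!: divide_strict_left_mono)
  qed (auto simp: near_def)
  then obtain u where u: "\<And>m. u m \<in> unit_cube"
    and surplus: "\<And>m S. S \<subseteq> {..<n - 1} \<Longrightarrow> S \<noteq> {} \<Longrightarrow> card S < card (\<Union>i\<in>S. near m (u m) i)"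
    by metis
  obtain t \<phi> where t: "t \<in> unit_cube" and \<phi>: "strict_mono \<phi>" and lim: "(u \<circ> \<phi>) \<longlonglongrightarrow> t"
    by (rule seq_compactE[OF compact_imp_seq_compact[OF compact_unit_cube], of u]) (use u in auto)
  have lim_f: "(\<lambda>m. f i k (u (\<phi> m))) \<longlonglongrightarrow> f i k t" if "i < n - 1" "k < n" for i k
    using cont[OF that] u t lim unfolding continuous_on_sequentially by (auto simp: o_def)
  have "\<epsilon> \<longlonglongrightarrow> 0"
    using LIMSEQ_ignore_initial_segment[OF LIMSEQ_inverse_real_of_nat, of n]
    by (simp add: \<epsilon>_def[abs_def] inverse_eq_divide add.commute)
  then have lim_\<epsilon>: "(\<lambda>m. \<epsilon> (\<phi> m)) \<longlonglongrightarrow> 0"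
    using LIMSEQ_subseq_LIMSEQ[OF _ \<phi>] by (simp add: o_def)
  define best where "best i = {k. k < n \<and> (\<forall>l<n. f i l t \<le> f i k t)}" for i
  have "\<forall>\<^sub>F m in sequentially. k \<in> near (\<phi> m) (u (\<phi> m)) i \<longrightarrow> k \<in> best i"
    if "i < n - 1" "k < n" for i k
  proof (cases "k \<in> best i")
    case False
    then obtain l where l: "l < n" "f i k t < f i l t" using \<open>k < n\<close> by (auto simp: best_def not_le)
    have "(\<lambda>m. f i k (u (\<phi> m)) + \<epsilon> (\<phi> m) - f i l (u (\<phi> m))) \<longlonglongrightarrow> f i k t + 0 - f i l t"
      using that l by (intro tendsto_intros lim_f lim_\<epsilon>)
    then have "\<forall>\<^sub>F m in sequentially. f i k (u (\<phi> m)) + \<epsilon> (\<phi> m) - f i l (u (\<phi> m)) < 0"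
      using l by (intro order_tendstoD(2)) auto
    then show ?thesis
      by eventually_elim (use l(1) in \<open>force simp: near_def\<close>)
  qed auto
  then have "\<forall>\<^sub>F m in sequentially. \<forall>i\<in>{..<n - 1}. \<forall>k\<in>{..<n}. k \<in> near (\<phi> m) (u (\<phi> m)) i \<longrightarrow> k \<in> best i"
    by (intro eventually_ball_finite ballI finite_lessThan) auto
  then obtain m where m: "\<forall>i\<in>{..<n - 1}. \<forall>k\<in>{..<n}. k \<in> near (\<phi> m) (u (\<phi> m)) i \<longrightarrow> k \<in> best i"
    using eventually_happens'[OF sequentially_bot] by blast
  show thesis
  proof (rule that[OF t])
    fix S assume S: "S \<subseteq> {..<n - 1}" "S \<noteq> {}"
    have fin: "finite (\<Union>i\<in>S. best i)"
      by (rule finite_subset[of _ "{..<n}"]) (auto simp: best_def)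
    have "card S < card (\<Union>i\<in>S. near (\<phi> m) (u (\<phi> m)) i)" by (rule surplus[OF S])
    also have "\<dots> \<le> card (\<Union>i\<in>S. best i)"
    proof (intro card_mono fin UN_mono order_refl subsetI)
      fix i k assume "i \<in> S" "k \<in> near (\<phi> m) (u (\<phi> m)) i"
      then show "k \<in> best i" using m S(1) by (auto simp: near_def)
    qed
    finally show "card S < card (\<Union>i\<in>S. {k. k < n \<and> (\<forall>l<n. f i l t \<le> f i k t)})"
      by (simp add: best_def)
  qed
qed

section \<open>Envy-free partitions\<close>

text \<open>
  The surplus of one in Hall's condition pays for any single piece \<open>k\<close> that the last agent takes.
\<close>

lemma permutation_with_secret_agent:
  fixes n :: nat
  assumes k: "k < n" and N: "\<And>i. i < n - 1 \<Longrightarrow> N i \<subseteq> {..<n}"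
    and surplus: "\<And>S. S \<subseteq> {..<n - 1} \<Longrightarrow> S \<noteq> {} \<Longrightarrow> card S < card (\<Union>i\<in>S. N i)"
  obtains \<pi> where "\<pi> permutes {..<n}" "\<pi> (n - 1) = k" "\<And>i. i < n - 1 \<Longrightarrow> \<pi> i \<in> N i"
proof -
  have "\<exists>p. inj_on p {..<n - 1} \<and> (\<forall>i\<in>{..<n - 1}. p i \<in> N i - {k})"
  proof (rule Hall_marriage)
    show "finite (N i - {k})" if "i \<in> {..<n - 1}" for i
      using finite_subset[OF N[of i]] that by simp
    fix S assume S: "S \<subseteq> {..<n - 1}"
    show "card S \<le> card (\<Union>i\<in>S. N i - {k})"
    proof (cases "S = {}")
      case False
      have "(\<Union>i\<in>S. N i - {k}) = (\<Union>i\<in>S. N i) - {k}" by auto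
      then show ?thesis using surplus[OF S False] by (auto simp: card_Diff_singleton_if)
    qed simp
  qed simp
  then obtain p where p: "inj_on p {..<n - 1}" "\<And>i. i < n - 1 \<Longrightarrow> p i \<in> N i - {k}" by auto
  define \<pi> where "\<pi> i = (if i < n - 1 then p i else if i = n - 1 then k else i)" for i
  have inj: "inj_on \<pi> {..<n}"
  proof (rule inj_onI)
    fix x y assume xy: "x \<in> {..<n}" "y \<in> {..<n}" "\<pi> x = \<pi> y"
    show "x = y"
    proof (cases "x < n - 1"; cases "y < n - 1")
      assume "x < n - 1" "y < n - 1"
      then show ?thesis using xy p(1) by (auto simp: \<pi>_def inj_on_def)
    next
      assume "x < n - 1" "\<not> y < n - 1"
      then show ?thesis using xy p(2)[of x] by (auto simp: \<pi>_def split: if_splits)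
    next
      assume "\<not> x < n - 1" "y < n - 1"
      then show ?thesis using xy p(2)[of y] by (auto simp: \<pi>_def split: if_splits)
    next
      assume "\<not> x < n - 1" "\<not> y < n - 1"
      then show ?thesis using xy by auto
    qed
  qed
  have "\<pi> ` {..<n} \<subseteq> {..<n}"
  proof (rule image_subsetI)
    fix i assume "i \<in> {..<n}"
    then show "\<pi> i \<in> {..<n}"
      using p(2)[of i] N[of i] k by (auto simp: \<pi>_def)
  qed
  then have "\<pi> ` {..<n} = {..<n}"
    using inj by (simp add: endo_inj_surj)
  then have "bij_betw \<pi> {..<n} {..<n}"
    using inj by (simp add: bij_betw_def)
  then have "\<pi> permutes {..<n}"
  proof (rule bij_imp_permutes)
    show "\<pi> i = i" if "i \<notin> {..<n}" for i
      using that k by (auto simp: \<pi>_def)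
  qed
  then show thesis
  proof (rule that)
    show "\<pi> (n - 1) = k" by (simp add: \<pi>_def)
    show "\<pi> i \<in> N i" if "i < n - 1" for i using p(2)[OF that] that by (simp add: \<pi>_def)
  qed
qed

theorem corollary3p3:
  fixes n :: nat and \<A> :: "(real ^ 'd) set list set"
  assumes "n \<ge> 1"
    and "nested_hyperplane_space n \<A>"
  shows "(\<forall>\<mu> :: nat \<Rightarrow> (real ^ 'd) measure.
            (\<forall>i<n. ac_prob_measure (\<mu> i)) \<longrightarrow> (\<exists>C\<in>\<A>. envy_free n \<mu> C))
       \<and> (\<forall>\<mu> :: nat \<Rightarrow> (real ^ 'd) measure.
            (\<forall>i<n - 1. ac_prob_measure (\<mu> i)) \<longrightarrow>
            (\<exists>C\<in>\<A>. \<forall>\<nu>. ac_prob_measure \<nu> \<longrightarrow> envy_free n (\<mu>(n - 1 := \<nu>)) C))"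
proof -
  have secret: "\<exists>C\<in>\<A>. \<forall>\<nu>. envy_free n (\<mu>(n - 1 := \<nu>)) C"
    if \<mu>: "\<forall>i<n - 1. ac_prob_measure (\<mu> i)" for \<mu> :: "nat \<Rightarrow> (real ^ 'd) measure"
  proof -
    obtain \<Phi> L R where \<Phi>: "cut_coordinates n \<A> L R \<Phi>"
      using nested_hyperplane_space_has_cut_coordinates[OF assms(2)] by blast
    note in_space = cut_coordinatesD(2)[OF \<Phi>]
    have closed: "closed (\<Phi> t ! k)" if "k < n" for t k
      using closed_nested_piece[OF assms(2) in_space that] .
    define f where "f i k t = measure (\<mu> i) (\<Phi> t ! k)" for i k t
    have cont: "continuous_on unit_cube (f i k)" if "i < n - 1" "k < n" for i k
    proof (rule continuous_on_sequentiallyI)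
      fix u :: "nat \<Rightarrow> nat \<Rightarrow> real" and t assume "u \<longlonglongrightarrow> t"
      then have "AE y in lborel. \<forall>\<^sub>F m in sequentially. y \<in> \<Phi> (u m) ! k \<longleftrightarrow> y \<in> \<Phi> t ! k"
        using cut_coordinatesD(5)[OF \<Phi>, of u t] \<open>k < n\<close> by (auto elim!: eventually_mono)
      then show "(\<lambda>m. f i k (u m)) \<longlonglongrightarrow> f i k t"
        unfolding f_def using \<mu> that closed by (intro tendsto_measure_of_AE_eventually) auto
    qed
    have total: "(\<Sum>k<n. f i k t) \<ge> 1" if "i < n - 1" for i t
    proof -
      interpret prob_space "\<mu> i" using \<mu> that by (simp add: ac_prob_measure_def)
      have sets: "sets (\<mu> i) = sets borel" using \<mu> that by (simp add: ac_prob_measure_def)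
      have "1 = prob (\<Union>k\<in>{..<n}. \<Phi> t ! k)"
      proof -
        have "(\<Union>k\<in>{..<n}. \<Phi> t ! k) = space (\<mu> i)"
          using nested_pieces_cover[OF assms(2) in_space[of t]] sets_eq_imp_space_eq[OF sets] by auto
        then show ?thesis by (simp add: prob_space)
      qed
      also have "\<dots> \<le> (\<Sum>k<n. prob (\<Phi> t ! k))"
        using closed by (intro finite_measure_subadditive_finite) (auto simp: sets borel_closed)
      finally show ?thesis by (simp add: f_def)
    qed
    obtain t where surplus: "\<And>S. S \<subseteq> {..<n - 1} \<Longrightarrow> S \<noteq> {} \<Longrightarrow>
        card S < card (\<Union>i\<in>S. {k. k < n \<and> (\<forall>l<n. f i l t \<le> f i k t)})"
    proof (rule surplus_demand[OF _ cut_coordinatesD(1)[OF \<Phi>] cont total])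
      show "f i k t = 0" if "j < n - 1" "t j = 0" "k \<in> L j" for i j k t
        using cut_coordinatesD(3)[OF \<Phi>, of j t k] that by (simp add: f_def)
      show "f i k t = 0" if "j < n - 1" "t j = 1" "k \<in> R j" for i j k t
        using cut_coordinatesD(4)[OF \<Phi>, of j t k] that by (simp add: f_def)
    qed (use assms(1) in auto)
    have "envy_free n (\<mu>(n - 1 := \<nu>)) (\<Phi> t)" for \<nu>
    proof -
      let ?v = "\<lambda>k. measure \<nu> (\<Phi> t ! k)"
      have "Max (?v ` {..<n}) \<in> ?v ` {..<n}"
        using assms(1) by (intro Max_in) (auto simp: lessThan_empty_iff)
      then obtain k where k: "k < n" "?v k = Max (?v ` {..<n})" by auto
      have best: "?v l \<le> ?v k" if "l < n" for l
        unfolding k(2) using that by (intro Max_ge) auto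
      obtain \<pi> where \<pi>: "\<pi> permutes {..<n}" "\<pi> (n - 1) = k"
        "\<And>i. i < n - 1 \<Longrightarrow> \<pi> i \<in> {k. k < n \<and> (\<forall>l<n. f i l t \<le> f i k t)}"
        using permutation_with_secret_agent[OF k(1), of "\<lambda>i. {k. k < n \<and> (\<forall>l<n. f i l t \<le> f i k t)}"] surplus
        by blast
      show ?thesis
        unfolding envy_free_def
      proof (intro exI[of _ \<pi>] conjI allI impI \<pi>(1))
        fix i i' assume i: "i < n" "i' < n"
        have "\<pi> i' < n" using permutes_in_image[OF \<pi>(1), of i'] i by simp
        then show "measure ((\<mu>(n - 1 := \<nu>)) i) (\<Phi> t ! \<pi> i) \<ge> measure ((\<mu>(n - 1 := \<nu>)) i) (\<Phi> t ! \<pi> i')"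
          using i best \<pi>(2) \<pi>(3)[of i] by (cases "i = n - 1") (auto simp: f_def)
      qed
    qed
    then show ?thesis using in_space by blast
  qed
  show ?thesis
  proof (intro conjI allI impI)
    fix \<mu> :: "nat \<Rightarrow> (real ^ 'd) measure"
    assume "\<forall>i<n. ac_prob_measure (\<mu> i)"
    then have "\<forall>i<n - 1. ac_prob_measure (\<mu> i)" by auto
    from secret[OF this] obtain C
      where "C \<in> \<A>" "envy_free n (\<mu>(n - 1 := \<mu> (n - 1))) C" by blast
    then show "\<exists>C\<in>\<A>. envy_free n \<mu> C" by auto
  next
    fix \<mu> :: "nat \<Rightarrow> (real ^ 'd) measure"
    assume "\<forall>i<n - 1. ac_prob_measure (\<mu> i)"
    then show "\<exists>C\<in>\<A>. \<forall>\<nu>. ac_prob_measure \<nu> \<longrightarrow> envy_free n (\<mu>(n - 1 := \<nu>)) C"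
      using secret[of \<mu>] by blast
  qed
qed

end
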